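(* Let $f\colon X\to X$ be a continuous transformation of a Polish space $X$. If the set $\{x\in X\colon \mathcal{C}_x=X\}$ is nonempty, then it is residual in $X$.
   Context: $X$ is equipped with a complete separable metric $d$. For $x\in X$, a closed set $C\subseteq X$ is a center of attraction of the (discrete-time) motion $(f^n(x))_{n\ge0}$ if for every $\varepsilon>0$, $$\lim_{N\to+\infty}\frac1N\sum_{n=0}^{N-1}\mathds{1}_{B_\varepsilon(C)}(f^n(x))=1,$$ where $B_\varepsilon(C)$ is the $\varepsilon$-neighborhood of $C$ in $X$ and $\mathds{1}_E$ is the characteristic function of $E$. It is the minimal center of attraction of the motion of $x$, denoted $\mathcal{C}_x$, if no proper subset of it is also a center of attraction of that motion. Thus $\mathcal{C}_x=X$ means that $X$ is the minimal center of attraction of the motion of $x$. A subset of $X$ is residual if it contains a dense $G_\delta$ subset of $X$. *)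

theory Defs
  imports "HOL-Analysis.Analysis"
begin

definition nbhd :: "real \<Rightarrow> 'a::metric_space set \<Rightarrow> 'a set"
  where "nbhd \<epsilon> C = (\<Union>c\<in>C. ball c \<epsilon>)"

(* The term N = 0 of the sequence is 0 (division by zero) and does not affect the limit. *)
definition center_of_attraction :: "('a::metric_space \<Rightarrow> 'a) \<Rightarrow> 'a \<Rightarrow> 'a set \<Rightarrow> bool"
  where "center_of_attraction f x C \<longleftrightarrow>
    closed C \<and>
    (\<forall>\<epsilon>>0. (\<lambda>N::nat. (1 / real N) * (\<Sum>n<N. indicator (nbhd \<epsilon> C) ((f ^^ n) x) :: real))
              \<longlonglongrightarrow> 1)"

(* The equation "C_x = C" is rendered as this relation: a minimal center of attraction need not
   exist for an arbitrary motion in a non-compact space, so C_x is not a total function of x. *)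
definition minimal_center_of_attraction :: "('a::metric_space \<Rightarrow> 'a) \<Rightarrow> 'a \<Rightarrow> 'a set \<Rightarrow> bool"
  where "minimal_center_of_attraction f x C \<longleftrightarrow>
    center_of_attraction f x C \<and> (\<forall>D. D \<subset> C \<longrightarrow> \<not> center_of_attraction f x D)"

definition residual :: "'a::topological_space set \<Rightarrow> bool"
  where "residual S \<longleftrightarrow> (\<exists>G. gdelta G \<and> closure G = UNIV \<and> G \<subseteq> S)"

end

theory Submission
  imports Defs
begin

text \<open>
  The motion of \<open>x\<close> has the whole space as its minimal center of attraction iff it visits every
  nonempty open set with positive upper density. If one point \<open>x\<close> does so, then so does its whole
  orbit, which is dense, and with a bound on the upper density that depends only on the open set.
  For a fixed bound, having frequencies above it for arbitrarily large times is a
  \<open>G\<^sub>\<delta>\<close> condition, because membership in an open set is stable under perturbation;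
  it suffices to impose it on a countable basis.
\<close>

section \<open>Visit frequencies and upper density\<close>

definition visit_freq :: "('a \<Rightarrow> 'a) \<Rightarrow> 'a \<Rightarrow> 'a set \<Rightarrow> nat \<Rightarrow> real"
  where "visit_freq f x U N = 1 / real N * (\<Sum>n<N. indicator U ((f ^^ n) x))"

text \<open>This says that the limsup of \<open>visit_freq f x U\<close> is positive. The explicit
  bound \<open>c\<close> is what can later be fixed uniformly along an orbit.\<close>

definition positive_upper_density :: "('a \<Rightarrow> 'a) \<Rightarrow> 'a \<Rightarrow> 'a set \<Rightarrow> bool"
  where "positive_upper_density f x U \<longleftrightarrow> (\<exists>c>0. \<exists>\<^sub>F N in sequentially. c < visit_freq f x U N)"

lemma visit_freq_nonneg: "0 \<le> visit_freq f x U N"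
  by (simp add: visit_freq_def sum_nonneg)

lemma visit_freq_mono: "U \<subseteq> V \<Longrightarrow> visit_freq f x U N \<le> visit_freq f x V N"
  unfolding visit_freq_def by (intro mult_left_mono sum_mono) (auto simp: indicator_def)

lemma visit_freq_compl:
  assumes "N > 0"
  shows "visit_freq f x (- U) N = 1 - visit_freq f x U N"
proof -
  have "(\<Sum>n<N. indicator (- U) ((f ^^ n) x) :: real) = real N - (\<Sum>n<N. indicator U ((f ^^ n) x))"
    by (simp add: indicator_compl sum_subtractf)
  then show ?thesis
    using assms by (simp add: visit_freq_def field_simps)
qed

lemma tendsto_visit_freq_compl_iff:
  "visit_freq f x (- U) \<longlonglongrightarrow> 1 \<longleftrightarrow> visit_freq f x U \<longlonglongrightarrow> 0"
proof -
  \<comment> \<open>The two frequencies add up to 1 only for \<open>N > 0\<close>: at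
    \<open>N = 0\<close> division by zero makes both 0.\<close>
  have "visit_freq f x (- U) \<longlonglongrightarrow> 1 \<longleftrightarrow> (\<lambda>N. 1 - visit_freq f x U N) \<longlonglongrightarrow> 1 - 0"
    unfolding diff_zero
    by (intro filterlim_cong refl eventually_mono[OF eventually_gt_at_top[of 0]] visit_freq_compl)
  also have "\<dots> \<longleftrightarrow> visit_freq f x U \<longlonglongrightarrow> 0"
    using tendsto_diff[OF tendsto_const[of 1], of "\<lambda>N. 1 - visit_freq f x U N" "1 - 0" sequentially]
      tendsto_diff[OF tendsto_const[of 1], of "visit_freq f x U" 0 sequentially]
    by auto
  finally show ?thesis .
qed

text \<open>Since frequencies are nonnegative, being eventually at most every \<open>c > 0\<close>
  is the same as tending to 0.\<close>

lemma not_positive_upper_density_iff: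
  "\<not> positive_upper_density f x U \<longleftrightarrow> visit_freq f x U \<longlonglongrightarrow> 0"
proof
  assume null: "\<not> positive_upper_density f x U"
  have le: "\<forall>\<^sub>F N in sequentially. visit_freq f x U N \<le> c" if "c > 0" for c
  proof -
    have "\<not> (\<exists>\<^sub>F N in sequentially. c < visit_freq f x U N)"
      using null that unfolding positive_upper_density_def by blast
    then show ?thesis
      by (simp add: not_frequently not_less)
  qed
  show "visit_freq f x U \<longlonglongrightarrow> 0"
  proof (rule order_tendstoI)
    fix a :: real assume "a < 0"
    then show "\<forall>\<^sub>F N in sequentially. a < visit_freq f x U N"
      using visit_freq_nonneg[of f x U] by (auto intro: always_eventually less_le_trans)
  next
    fix a :: real assume "0 < a"
    then show "\<forall>\<^sub>F N in sequentially. visit_freq f x U N < a"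
      using le[of "a / 2"] by (auto elim!: eventually_mono)
  qed
next
  assume lim: "visit_freq f x U \<longlonglongrightarrow> 0"
  have "\<not> (\<exists>\<^sub>F N in sequentially. c < visit_freq f x U N)" if "c > 0" for c
    using order_tendstoD(2)[OF lim that] by (auto simp: not_frequently elim!: eventually_mono)
  then show "\<not> positive_upper_density f x U"
    by (auto simp: positive_upper_density_def)
qed

lemma positive_upper_density_mono:
  assumes "U \<subseteq> V" "positive_upper_density f x U"
  shows "positive_upper_density f x V"
  using assms visit_freq_mono[OF assms(1), of f x]
  by (fastforce simp: positive_upper_density_def elim!: frequently_elim1 intro: less_le_trans)

section \<open>Minimality of the whole space as a density condition\<close>

lemma center_of_attraction_iff:
  "center_of_attraction f x C \<longleftrightarrow> closed C \<and> (\<forall>\<epsilon>>0. visit_freq f x (nbhd \<epsilon> C) \<longlonglongrightarrow> 1)"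
  by (simp add: center_of_attraction_def visit_freq_def[abs_def])

lemma subset_nbhd: "\<epsilon> > 0 \<Longrightarrow> C \<subseteq> nbhd \<epsilon> C"
  by (auto simp: nbhd_def intro: centre_in_ball[THEN iffD2])

text \<open>An open set \<open>U\<close> of zero density would make \<open>- U\<close> a smaller
  center. Conversely, a proper center \<open>D\<close> has a neighborhood that misses some ball, and
  that ball would then have zero density.\<close>

lemma minimal_center_of_attraction_UNIV_iff:
  "minimal_center_of_attraction f x UNIV \<longleftrightarrow>
    (\<forall>U. open U \<longrightarrow> U \<noteq> {} \<longrightarrow> positive_upper_density f x U)"
proof (intro iffI allI impI)
  fix U :: "'a set"
  assume minimal: "minimal_center_of_attraction f x UNIV" and U: "open U" "U \<noteq> {}"
  show "positive_upper_density f x U"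
  proof (rule ccontr)
    assume "\<not> positive_upper_density f x U"
    \<comment> \<open>The points at distance at least \<epsilon> from every point of
      \<open>- U\<close> all lie in \<open>U\<close>, so they inherit its zero density.\<close>
    then have "visit_freq f x (- nbhd \<epsilon> (- U)) \<longlonglongrightarrow> 0" if "\<epsilon> > 0" for \<epsilon>
      using positive_upper_density_mono[of "- nbhd \<epsilon> (- U)" U f x] subset_nbhd[OF that, of "- U"]
      by (auto simp flip: not_positive_upper_density_iff)
    then have "visit_freq f x (nbhd \<epsilon> (- U)) \<longlonglongrightarrow> 1" if "\<epsilon> > 0" for \<epsilon>
      using tendsto_visit_freq_compl_iff[of f x "- nbhd \<epsilon> (- U)"] that by simp
    then have "center_of_attraction f x (- U)"
      using U by (simp add: center_of_attraction_iff closed_Compl)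
    then show False
      using minimal U by (auto simp: minimal_center_of_attraction_def)
  qed
next
  assume dens: "\<forall>U. open U \<longrightarrow> U \<noteq> {} \<longrightarrow> positive_upper_density f x U"
  have "visit_freq f x UNIV \<longlonglongrightarrow> 1"
    using tendsto_visit_freq_compl_iff[of f x "{}"] by (simp add: visit_freq_def[abs_def])
  moreover have "nbhd \<epsilon> UNIV = (UNIV :: 'a set)" if "\<epsilon> > 0" for \<epsilon>
    using subset_nbhd[OF that, of "UNIV :: 'a set"] by auto
  ultimately have "center_of_attraction f x UNIV"
    by (simp add: center_of_attraction_iff)
  moreover have "\<not> center_of_attraction f x D" if "D \<subset> UNIV" for D
  proof
    assume D: "center_of_attraction f x D"
    obtain y where "y \<in> - D"
      using \<open>D \<subset> UNIV\<close> by auto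
    moreover have "open (- D)"
      using D by (simp add: center_of_attraction_iff open_Compl)
    ultimately obtain \<epsilon> where \<epsilon>: "\<epsilon> > 0" "ball y \<epsilon> \<subseteq> - D"
      by (meson openE)
    \<comment> \<open>Halving the radius leaves room on both sides: by the triangle inequality the
      small ball misses a whole neighborhood of \<open>D\<close>, not just \<open>D\<close>.\<close>
    have "ball y (\<epsilon> / 2) \<subseteq> - nbhd (\<epsilon> / 2) D"
    proof
      fix z assume z: "z \<in> ball y (\<epsilon> / 2)"
      have "z \<notin> ball c (\<epsilon> / 2)" if "c \<in> D" for c
      proof
        assume "z \<in> ball c (\<epsilon> / 2)"
        then have "dist y c < \<epsilon>"
          using z dist_triangle2[of y c z] by (auto simp: dist_commute)
        then show False
          using \<epsilon> that by auto
      qed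
      then show "z \<in> - nbhd (\<epsilon> / 2) D"
        by (auto simp: nbhd_def)
    qed
    moreover have "positive_upper_density f x (ball y (\<epsilon> / 2))"
      using dens \<epsilon> by simp
    ultimately have "\<not> visit_freq f x (- nbhd (\<epsilon> / 2) D) \<longlonglongrightarrow> 0"
      using positive_upper_density_mono not_positive_upper_density_iff by metis
    moreover have "visit_freq f x (nbhd (\<epsilon> / 2) D) \<longlonglongrightarrow> 1"
      using D \<epsilon> by (simp add: center_of_attraction_iff)
    ultimately show False
      using tendsto_visit_freq_compl_iff[of f x "- nbhd (\<epsilon> / 2) D"] by simp
  qed
  ultimately show "minimal_center_of_attraction f x UNIV"
    by (auto simp: minimal_center_of_attraction_def)
qed

section \<open>Stability of visits under perturbation\<close>

lemma continuous_on_funpow: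
  fixes f :: "'a::topological_space \<Rightarrow> 'a"
  assumes "continuous_on UNIV f"
  shows "continuous_on UNIV (f ^^ n)"
proof (induction n)
  case (Suc n)
  then show ?case
    using continuous_on_compose[of UNIV "f ^^ n" f] continuous_on_subset[OF assms] by simp
qed (simp add: id_def)

lemma open_visit_freq_greater:
  fixes f :: "'a::topological_space \<Rightarrow> 'a"
  assumes f: "continuous_on UNIV f" and U: "open U"
  shows "open {x. c < visit_freq f x U N}"
proof (subst open_subopen, intro ballI)
  fix x assume x: "x \<in> {x. c < visit_freq f x U N}"
  \<comment> \<open>Every point of \<open>V\<close> visits \<open>U\<close> at least whenever
    \<open>x\<close> does before time \<open>N\<close>. Only finitely many times are involved, so
    \<open>V\<close> is open.\<close>
  define V where "V = (\<Inter>n\<in>{n. n < N \<and> (f ^^ n) x \<in> U}. (f ^^ n) -` U)"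
  have "open V"
    unfolding V_def by (intro open_INT ballI open_vimage U continuous_on_funpow f) simp
  moreover have "x \<in> V"
    by (simp add: V_def)
  moreover have "visit_freq f x U N \<le> visit_freq f y U N" if "y \<in> V" for y
    unfolding visit_freq_def using that
    by (intro mult_left_mono sum_mono) (auto simp: V_def indicator_def)
  then have "V \<subseteq> {x. c < visit_freq f x U N}"
    using x by (auto intro: less_le_trans)
  ultimately show "\<exists>T. open T \<and> x \<in> T \<and> T \<subseteq> {x. c < visit_freq f x U N}"
    by blast
qed

section \<open>Frequencies along an orbit\<close>

lemma sum_shift_ge:
  fixes a :: "nat \<Rightarrow> real"
  assumes "\<And>n. 0 \<le> a n" "\<And>n. a n \<le> 1"
  shows "(\<Sum>n<N. a n) - real k \<le> (\<Sum>n<N. a (n + k))"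
proof (induction k)
  case (Suc k)
  \<comment> \<open>Moving the window one step further loses \<open>a k\<close>, at most 1, and
    gains \<open>a (N + k)\<close>, at least 0.\<close>
  have "(\<Sum>n<N. a (n + Suc k)) = (\<Sum>n<N. a (n + k)) + a (N + k) - a k"
    by (induction N) auto
  then show ?case
    using Suc assms(1)[of "N + k"] assms(2)[of k] by simp
qed simp

lemma visit_freq_funpow_ge:
  "visit_freq f x U N - real k / real N \<le> visit_freq f ((f ^^ k) x) U N"
proof -
  have "(\<Sum>n<N. indicator U ((f ^^ n) x)) - real k \<le> (\<Sum>n<N. indicator U ((f ^^ n) ((f ^^ k) x)))"
    using sum_shift_ge[of "\<lambda>n. indicator U ((f ^^ n) x)" N k] by (simp add: funpow_add)
  then have "((\<Sum>n<N. indicator U ((f ^^ n) x)) - real k) / real N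
      \<le> (\<Sum>n<N. indicator U ((f ^^ n) ((f ^^ k) x))) / real N"
    by (rule divide_right_mono) simp
  then show ?thesis
    by (simp add: visit_freq_def diff_divide_distrib)
qed

text \<open>Starting \<open>k\<close> steps later costs at most \<open>k / N\<close>, which is
  eventually below the gap \<open>c' - c\<close>. The pair \<open>c\<close>, \<open>c'\<close> works
  for every \<open>k\<close>.\<close>

lemma frequently_visit_freq_funpow:
  assumes "c < c'" and freq: "\<exists>\<^sub>F N in sequentially. c' < visit_freq f x U N"
  shows "\<exists>\<^sub>F N in sequentially. c < visit_freq f ((f ^^ k) x) U N"
proof -
  have "(\<lambda>N. real k / real N) \<longlonglongrightarrow> 0"
    by (rule lim_const_over_n)
  then have "\<forall>\<^sub>F N in sequentially. real k / real N < c' - c"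
    using assms by (intro order_tendstoD) auto
  then have "\<forall>\<^sub>F N in sequentially. c' < visit_freq f x U N \<longrightarrow> c < visit_freq f ((f ^^ k) x) U N"
  proof eventually_elim
    case (elim N)
    then show ?case
      using visit_freq_funpow_ge[of f x U N k] by linarith
  qed
  then show ?thesis
    using freq by (rule frequently_mp)
qed

section \<open>Countable intersections and residuality\<close>

lemma gdelta_countable_INT:
  assumes "countable I" "\<And>i. i \<in> I \<Longrightarrow> open (F i)"
  shows "gdelta (\<Inter>i\<in>I. F i)"
proof (cases "I = {}")
  case True
  then show ?thesis
    using gdelta.intros[of "\<lambda>_. UNIV"] by simp
next
  case False
  then have "(\<Inter>i\<in>I. F i) = (\<Inter>n. F (from_nat_into I n))"
    using range_from_nat_into[OF False assms(1)] by (metis image_image)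
  then show ?thesis
    using assms(2) from_nat_into[OF False] by (simp add: gdelta.intros)
qed

text \<open>"Frequently" unfolds to: for every \<open>M\<close> some \<open>N\<close> beyond
  \<open>M\<close>. This is a countable intersection of unions of open sets.\<close>

lemma gdelta_frequently_visit_freq:
  fixes f :: "'a::topological_space \<Rightarrow> 'a"
  assumes "continuous_on UNIV f" "countable B" "\<And>U. U \<in> B \<Longrightarrow> open U"
  shows "gdelta (\<Inter>U\<in>B. {x. \<exists>\<^sub>F N in sequentially. c U < visit_freq f x U N})"
proof -
  have "(\<Inter>U\<in>B. {x. \<exists>\<^sub>F N in sequentially. c U < visit_freq f x U N}) =
      (\<Inter>(U, M)\<in>B \<times> (UNIV :: nat set). \<Union>N\<in>{M..}. {x. c U < visit_freq f x U N})"
    by (auto simp: frequently_sequentially)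
  also have "gdelta \<dots>"
    using assms by (intro gdelta_countable_INT) (auto intro!: open_UN open_visit_freq_greater)
  finally show ?thesis .
qed

theorem mainTheorem2:
  fixes f :: "'a::polish_space \<Rightarrow> 'a"
  assumes "continuous_on UNIV f"
    and "{x. minimal_center_of_attraction f x UNIV} \<noteq> {}"
  shows "residual {x. minimal_center_of_attraction f x UNIV}"
proof -
  obtain x where x: "\<And>U. open U \<Longrightarrow> U \<noteq> {} \<Longrightarrow> positive_upper_density f x U"
    using assms(2) by (auto simp: minimal_center_of_attraction_UNIV_iff)
  obtain B :: "'a set set" where B: "countable B" "topological_basis B"
    using ex_countable_basis by blast
  \<comment> \<open>The bound is chosen before \<open>k\<close>, so that the set \<open>G\<close>
    built from it contains the entire orbit of \<open>x\<close>.\<close>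
  have "\<exists>c>0. \<forall>k. \<exists>\<^sub>F N in sequentially. c < visit_freq f ((f ^^ k) x) U N"
    if "U \<in> B - {{}}" for U
  proof -
    have "positive_upper_density f x U"
      using that topological_basis_open[OF B(2), of U] by (intro x) auto
    then obtain c where "c > 0" "\<exists>\<^sub>F N in sequentially. c < visit_freq f x U N"
      unfolding positive_upper_density_def by blast
    then have "\<forall>k. \<exists>\<^sub>F N in sequentially. c / 2 < visit_freq f ((f ^^ k) x) U N"
      by (intro allI frequently_visit_freq_funpow[of "c / 2" c]) simp_all
    then show ?thesis
      using \<open>c > 0\<close> by (intro exI[of _ "c / 2"]) simp
  qed
  then obtain c where c: "\<And>U. U \<in> B - {{}} \<Longrightarrow> c U > 0"
    "\<And>U k. U \<in> B - {{}} \<Longrightarrow> \<exists>\<^sub>F N in sequentially. c U < visit_freq f ((f ^^ k) x) U N"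
    by metis
  define G where
    "G = (\<Inter>U\<in>B - {{}}. {y. \<exists>\<^sub>F N in sequentially. c U < visit_freq f y U N})"
  have "gdelta G"
    unfolding G_def using B topological_basis_open[OF B(2)]
    by (intro gdelta_frequently_visit_freq assms) auto
  moreover have "closure G = UNIV"
  proof -
    have "\<exists>y\<in>G. y \<in> U" if U: "open U" "U \<noteq> {}" for U
    proof -
      \<comment> \<open>The orbit is dense, since an open set it never enters would have frequency
        constantly 0.\<close>
      have "\<exists>k. (f ^^ k) x \<in> U"
      proof (rule ccontr)
        assume "\<nexists>k. (f ^^ k) x \<in> U"
        then have "visit_freq f x U = (\<lambda>_. 0)"
          by (auto simp: visit_freq_def)
        then show False
          using x[OF U] not_positive_upper_density_iff[of f x U] by simp
      qed
      then show ?thesis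
        using c(2) by (auto simp: G_def)
    qed
    then show ?thesis
      using closure_subset[of G]
      by (metis Compl_empty_eq ComplD double_complement open_Compl closed_closure subsetD)
  qed
  moreover have "minimal_center_of_attraction f y UNIV" if y: "y \<in> G" for y
    unfolding minimal_center_of_attraction_UNIV_iff
  proof (intro allI impI)
    fix U :: "'a set" assume "open U" "U \<noteq> {}"
    \<comment> \<open>Membership in \<open>G\<close> controls only basis sets, so a nonempty one is
      taken inside \<open>U\<close>; there the positive bound \<open>c V\<close> applies.\<close>
    then obtain V where V: "V \<in> B - {{}}" "V \<subseteq> U"
      using topological_basisE[OF B(2) \<open>open U\<close>]
      by (metis Diff_iff all_not_in_conv singletonD empty_iff)
    then have "positive_upper_density f y V"
      using y c(1) by (auto simp: G_def positive_upper_density_def)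
    then show "positive_upper_density f y U"
      by (rule positive_upper_density_mono[OF V(2)])
  qed
  ultimately show ?thesis
    unfolding residual_def by blast
qed

end
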